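(* Let $\mathbf{k}$ be an algebraically closed field, let $k\ge 1$, and let $\mathfrak{X}_k=\mathfrak{X}(F_k,\mathrm{SL}_2)$ be the $\mathrm{SL}_2$-character variety of the free group $F_k$ over $\mathbf{k}$. Then $\mathfrak{X}_k$ is parametrized by the functions $$T_{i_1\ldots i_p}(A_1,\ldots,A_k):=\operatorname{tr}(A_{i_1}\cdots A_{i_p}),\qquad 1\le i_1<\cdots<i_p\le k,\quad p\in\{1,2,3\},$$ where $A_1,\ldots,A_k\in\mathrm{SL}_2$. That is, for every monomial $x=A_{i_1}^{r_1}\cdots A_{i_m}^{r_m}$ with $1\le i_1,\ldots,i_m\le k$ and $r_j\in\mathbb{Z}$, the trace $\operatorname{tr}(x)$ has a polynomial expression in terms of these $T_{i_1\ldots i_p}$ with $p\le 3$, and therefore the coordinate ring is $$\mathcal{O}_{\mathfrak{X}_k}=\mathbf{k}\big[\{T_{i_1\ldots i_p}\}_{1\le i_1<\cdots<i_p\le k,\ 1\le p\le 3}\big]/\mathcal{I}$$ for some ideal $\mathcal{I}$ of relations.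
   Context: $F_k=\langle x_1,\ldots,x_k\rangle$ is the free group on $k$ generators. A representation $\rho:F_k\to \mathrm{SL}_2=\mathrm{SL}_2(\mathbf{k})$ is identified with the $k$-tuple $(A_1,\ldots,A_k)=(\rho(x_1),\ldots,\rho(x_k))\in(\mathrm{SL}_2)^k$. Its character is $\chi_\rho:F_k\to\mathbf{k}$, $\chi_\rho(g)=\operatorname{tr}\rho(g)$. The character variety $\mathfrak{X}(F_k,\mathrm{SL}_2)$ is the set of all characters $\chi_\rho$, with the structure of an affine variety whose coordinate ring $\mathcal{O}_{\mathfrak{X}_k}$ is the (finitely generated) subalgebra of the ring of regular functions on $(\mathrm{SL}_2)^k$ generated by all trace functions $\rho\mapsto\operatorname{tr}\rho(g)$, $g\in F_k$. It is identified with the GIT quotient $(\mathrm{SL}_2)^k/\!/\mathrm{SL}_2$ by simultaneous conjugation.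
   Formalization: The formal theorem assumes that the characteristic of the field is not 2 or that k ≤ 3; in characteristic 2 with k ≥ 4 the claim is false, since tr(A_1A_2A_3A_4) is not a polynomial in the T's with p ≤ 3. *)

theory Defs
  imports
    "HOL-Analysis.Determinants"
    "HOL-Computational_Algebra.Polynomial"
    "HOL-Library.Poly_Mapping"
    "HOL-Library.FuncSet"
    "HOL-Algebra.QuotRing"
    "HOL-Algebra.Generated_Rings"
begin

section \<open>The group \<open>SL\<^sub>2\<close>\<close>

definition SL2 :: "('a::field ^ 2 ^ 2) monoid" where
  "SL2 = \<lparr>carrier = {A. det A = 1}, mult = (**), one = mat 1\<rparr>"

lemma group_SL2: "group (SL2 :: ('a::field ^ 2 ^ 2) monoid)"
proof (rule groupI)
  fix A :: "'a ^ 2 ^ 2"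
  assume "A \<in> carrier SL2"
  then have dA: "det A = 1" by (simp add: SL2_def)
  then have "invertible A" by (simp add: invertible_det_nz)
  then obtain B where B: "A ** B = mat 1" "B ** A = mat 1"
    unfolding invertible_def by blast
  from B(1) dA have "det B = 1" by (metis det_I det_mul mult_1)
  with B(2) show "\<exists>y\<in>carrier SL2. y \<otimes>\<^bsub>SL2\<^esub> A = \<one>\<^bsub>SL2\<^esub>"
    by (auto simp: SL2_def)
qed (auto simp: SL2_def det_mul matrix_mul_assoc)

section \<open>The free group \<open>F\<^sub>k\<close> and its representations\<close>

text \<open>The letter \<open>(i, True)\<close> is \<open>x\<^sub>i\<close> and \<open>(i, False)\<close> is its inverse. Elements of
  \<open>F\<^sub>k\<close> are the reduced words.\<close>

type_synonym letter = "nat \<times> bool"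

definition inv_letter :: "letter \<Rightarrow> letter" where
  "inv_letter a = (fst a, \<not> snd a)"

definition reduced :: "letter list \<Rightarrow> bool" where
  "reduced w \<longleftrightarrow> successively (\<lambda>a b. b \<noteq> inv_letter a) w"

fun push :: "letter \<Rightarrow> letter list \<Rightarrow> letter list" where
  "push a [] = [a]"
| "push a (b # w) = (if b = inv_letter a then w else a # b # w)"

definition free_group :: "nat \<Rightarrow> letter list monoid" where
  "free_group k =
    \<lparr>carrier = {w. reduced w \<and> fst ` set w \<subseteq> {1..k}},
     mult = (\<lambda>u v. foldr push u v), one = []\<rparr>"

lemma inv_letter_inv_letter [simp]: "inv_letter (inv_letter a) = a"
  by (simp add: inv_letter_def)

lemma fst_inv_letter [simp]: "fst (inv_letter a) = fst a"
  by (simp add: inv_letter_def)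

lemma reduced_Nil [simp]: "reduced []"
  by (simp add: reduced_def)

lemma reduced_Cons:
  "reduced (a # w) \<longleftrightarrow> reduced w \<and> (w = [] \<or> hd w \<noteq> inv_letter a)"
  by (cases w) (auto simp: reduced_def)

lemma reduced_push: "reduced w \<Longrightarrow> reduced (push a w)"
  by (cases w) (auto simp: reduced_Cons)

lemma reduced_foldr_push: "reduced w \<Longrightarrow> reduced (foldr push u w)"
  by (induction u) (auto simp: reduced_push)

lemma set_push: "set (push a w) \<subseteq> insert a (set w)"
  by (cases w) auto

lemma set_foldr_push: "set (foldr push u w) \<subseteq> set u \<union> set w"
  by (induction u) (use set_push in fastforce)+

lemma push_reduced: "reduced (a # w) \<Longrightarrow> push a w = a # w"
  by (cases w) (auto simp: reduced_Cons)

lemma push_cancel: "reduced w \<Longrightarrow> push a (push (inv_letter a) w) = w"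
  by (cases w) (auto simp: push_reduced)

lemma foldr_push_push:
  assumes "reduced w"
  shows "foldr push (push a v) w = push a (foldr push v w)"
proof (cases v)
  case (Cons b v')
  show ?thesis
    using Cons push_cancel[OF reduced_foldr_push[OF assms], of a v'] by auto
qed auto

lemma foldr_push_assoc:
  "reduced w \<Longrightarrow> foldr push (foldr push u v) w = foldr push u (foldr push v w)"
  by (induction u) (auto simp: foldr_push_push)

lemma foldr_push_Nil: "reduced u \<Longrightarrow> foldr push u [] = u"
  by (induction u) (auto simp: push_reduced reduced_Cons)

lemma foldr_push_inverse:
  "reduced w \<Longrightarrow> foldr push (rev (map inv_letter u)) (foldr push u w) = w"
proof (induction u)
  case (Cons a u)
  then show ?case
    using push_cancel[OF reduced_foldr_push[OF Cons.prems], of "inv_letter a" u] by simp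
qed auto

lemma group_free_group: "group (free_group k)"
proof (rule groupI)
  fix u assume u: "u \<in> carrier (free_group k)"
  let ?v = "foldr push (rev (map inv_letter u)) []"
  have "fst ` set ?v \<subseteq> {1..k}"
  proof -
    have "fst ` set ?v \<subseteq> fst ` inv_letter ` set u"
      using set_foldr_push[of "rev (map inv_letter u)" "[]"] by (intro image_mono) simp
    also have "\<dots> = fst ` set u"
      by (simp add: image_image)
    also have "\<dots> \<subseteq> {1..k}" using u by (simp add: free_group_def)
    finally show ?thesis .
  qed
  then have "?v \<in> carrier (free_group k)"
    by (simp add: free_group_def reduced_foldr_push)
  moreover have "foldr push ?v u = []"
    using u foldr_push_inverse[of "[]" u]
    by (simp add: foldr_push_assoc free_group_def foldr_push_Nil)
  ultimately show "\<exists>y\<in>carrier (free_group k). y \<otimes>\<^bsub>free_group k\<^esub> u = \<one>\<^bsub>free_group k\<^esub>"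
    by (auto simp: free_group_def)
next
  fix u v assume "u \<in> carrier (free_group k)" "v \<in> carrier (free_group k)"
  then show "u \<otimes>\<^bsub>free_group k\<^esub> v \<in> carrier (free_group k)"
    using set_foldr_push[of u v] by (fastforce simp: free_group_def reduced_foldr_push)
qed (auto simp: free_group_def foldr_push_assoc)

definition SL2_tuples :: "nat \<Rightarrow> (nat \<Rightarrow> 'a::field ^ 2 ^ 2) set" where
  "SL2_tuples k = {1..k} \<rightarrow>\<^sub>E carrier SL2"

text \<open>The representation identified with a tuple \<open>A\<close>; see
  \<open>rep_of_tuple_hom\<close> and \<open>hom_eq_rep_of_tuple\<close>.\<close>

definition rep_of_tuple :: "(nat \<Rightarrow> 'a::field ^ 2 ^ 2) \<Rightarrow> letter list \<Rightarrow> 'a ^ 2 ^ 2" where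
  "rep_of_tuple A w =
    foldr (\<lambda>(i, e) M. (if e then A i else inv\<^bsub>SL2\<^esub> (A i)) \<otimes>\<^bsub>SL2\<^esub> M) w \<one>\<^bsub>SL2\<^esub>"

lemma rep_of_tuple_closed:
  assumes A: "A \<in> SL2_tuples k" and w: "fst ` set w \<subseteq> {1..k}"
  shows "rep_of_tuple A w \<in> carrier SL2"
proof -
  interpret group SL2 by (rule group_SL2)
  have A': "A i \<in> carrier SL2" if "i \<in> {1..k}" for i
    using A that by (auto simp: SL2_tuples_def)
  show ?thesis using w
    by (induction w) (auto simp: rep_of_tuple_def A')
qed

lemma rep_of_tuple_push:
  assumes A: "A \<in> SL2_tuples k" and w: "fst ` set w \<subseteq> {1..k}" and a: "fst a \<in> {1..k}"
  shows "rep_of_tuple A (push a w) = rep_of_tuple A (a # w)"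
proof (cases w)
  case (Cons b v)
  interpret group SL2 by (rule group_SL2)
  have A': "A (fst a) \<in> carrier SL2"
    using A a by (auto simp: SL2_tuples_def)
  have v: "rep_of_tuple A v \<in> carrier SL2"
    using A w Cons by (intro rep_of_tuple_closed) auto
  have "rep_of_tuple A (a # inv_letter a # v) = rep_of_tuple A v"
    using A' v m_assoc[symmetric, of _ _ "rep_of_tuple A v"]
    by (cases a) (auto simp: rep_of_tuple_def inv_letter_def)
  then show ?thesis using Cons by auto
qed auto

lemma rep_of_tuple_hom:
  assumes A: "A \<in> SL2_tuples k"
  shows "rep_of_tuple A \<in> hom (free_group k) SL2"
    and "\<And>i. i \<in> {1..k} \<Longrightarrow> rep_of_tuple A [(i, True)] = A i"
proof -
  interpret group SL2 by (rule group_SL2)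
  have A': "A i \<in> carrier SL2" if "i \<in> {1..k}" for i
    using A that by (auto simp: SL2_tuples_def)
  then show "\<And>i. i \<in> {1..k} \<Longrightarrow> rep_of_tuple A [(i, True)] = A i"
    by (simp add: rep_of_tuple_def)
  have "rep_of_tuple A (foldr push u v) = rep_of_tuple A u \<otimes>\<^bsub>SL2\<^esub> rep_of_tuple A v"
    if "fst ` set u \<subseteq> {1..k}" "fst ` set v \<subseteq> {1..k}" for u v
    using that
  proof (induction u)
    case Nil
    then show ?case
      using rep_of_tuple_closed[OF A, of v] by (simp add: rep_of_tuple_def)
  next
    case (Cons a u)
    obtain i e where a: "a = (i, e)" by (cases a)
    let ?M = "if e then A i else inv\<^bsub>SL2\<^esub> (A i)"
    have M: "?M \<in> carrier SL2" using A' Cons.prems a by auto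
    have Cons_eq: "rep_of_tuple A (a # w) = ?M \<otimes>\<^bsub>SL2\<^esub> rep_of_tuple A w" for w
      by (simp add: rep_of_tuple_def a)
    have "fst ` set (foldr push u v) \<subseteq> {1..k}"
      using set_foldr_push[of u v] Cons.prems by fastforce
    then have "rep_of_tuple A (foldr push (a # u) v) = rep_of_tuple A (a # foldr push u v)"
      using rep_of_tuple_push[OF A] Cons.prems by simp
    also have "\<dots> = rep_of_tuple A (a # u) \<otimes>\<^bsub>SL2\<^esub> rep_of_tuple A v"
      using Cons M rep_of_tuple_closed[OF A, of u] rep_of_tuple_closed[OF A, of v]
      unfolding Cons_eq by (simp add: m_assoc)
    finally show ?case .
  qed
  then show "rep_of_tuple A \<in> hom (free_group k) SL2"
    using rep_of_tuple_closed[OF A] by (auto simp: hom_def free_group_def)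
qed

lemma hom_eq_rep_of_tuple:
  assumes \<rho>: "\<rho> \<in> hom (free_group k) SL2" and w: "w \<in> carrier (free_group k)"
  shows "\<rho> w = rep_of_tuple (\<lambda>i\<in>{1..k}. \<rho> [(i, True)]) w"
proof -
  interpret F: group "free_group k" by (rule group_free_group)
  interpret S: group SL2 by (rule group_SL2)
  interpret h: group_hom "free_group k" SL2 \<rho> by unfold_locales (rule \<rho>)
  have letter: "\<rho> [(i, e)] = (if e then \<rho> [(i, True)] else inv\<^bsub>SL2\<^esub> (\<rho> [(i, True)]))"
    if i: "i \<in> {1..k}" for i e
  proof (cases e)
    case False
    have "[(i, False)] = inv\<^bsub>free_group k\<^esub> [(i, True)]"
      using i by (intro F.inv_equality[symmetric])
        (auto simp: free_group_def inv_letter_def reduced_def)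
    moreover have "[(i, True)] \<in> carrier (free_group k)"
      using i by (auto simp: free_group_def reduced_def)
    ultimately show ?thesis using False by simp
  qed auto
  show ?thesis using w
  proof (induction w)
    case Nil
    show ?case using h.hom_one by (simp add: rep_of_tuple_def free_group_def)
  next
    case (Cons a w)
    obtain i e where a: "a = (i, e)" by (cases a)
    have mem: "[a] \<in> carrier (free_group k)" "w \<in> carrier (free_group k)" and i: "i \<in> {1..k}"
      using Cons.prems a by (auto simp: free_group_def reduced_Cons)
    have "a # w = [a] \<otimes>\<^bsub>free_group k\<^esub> w"
      using Cons.prems by (simp add: free_group_def push_reduced)
    then have "\<rho> (a # w) = \<rho> [a] \<otimes>\<^bsub>SL2\<^esub> \<rho> w"
      using mem by simp
    then show ?case
      using Cons.IH[OF mem(2)] letter[OF i, of e] i by (simp add: rep_of_tuple_def a)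
  qed
qed

definition character :: "nat \<Rightarrow> (letter list \<Rightarrow> 'a::field ^ 2 ^ 2) \<Rightarrow> letter list \<Rightarrow> 'a" where
  "character k \<rho> = (\<lambda>g\<in>carrier (free_group k). trace (\<rho> g))"

definition character_variety :: "nat \<Rightarrow> (letter list \<Rightarrow> 'a::field) set" where
  "character_variety k = character k ` hom (free_group k) SL2"

section \<open>Polynomials in several variables\<close>

type_synonym ('v, 'a) mpoly = "('v \<Rightarrow>\<^sub>0 nat) \<Rightarrow>\<^sub>0 'a"

definition mpoly_eval :: "('v \<Rightarrow> 'a::comm_ring_1) \<Rightarrow> ('v, 'a) mpoly \<Rightarrow> 'a" where
  "mpoly_eval f p =
    (\<Sum>m\<in>Poly_Mapping.keys p. Poly_Mapping.lookup p m * (\<Prod>v\<in>Poly_Mapping.keys m. f v ^ Poly_Mapping.lookup m v))"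

definition mpoly_ring :: "'v set \<Rightarrow> ('v, 'a::comm_ring_1) mpoly ring" where
  "mpoly_ring V =
    \<lparr>carrier = {p. \<forall>m\<in>Poly_Mapping.keys p. Poly_Mapping.keys m \<subseteq> V}, mult = (*), one = 1, zero = 0, add = (+)\<rparr>"

section \<open>The coordinate ring of the character variety\<close>

text \<open>Regular functions are polynomials in the entries \<open>(i, r, c) \<mapsto> (A\<^sub>i)\<^sub>r\<^sub>c\<close>; as functions
  on \<open>(SL\<^sub>2)\<^sup>k\<close> they are restricted, so that equality is equality on \<open>(SL\<^sub>2)\<^sup>k\<close>.\<close>

definition regular_ring :: "nat \<Rightarrow> ((nat \<Rightarrow> 'a::field ^ 2 ^ 2) \<Rightarrow> 'a) ring" where
  "regular_ring k =
    \<lparr>carrier = {\<lambda>A\<in>SL2_tuples k. mpoly_eval (\<lambda>(i, r, c). A i $ r $ c) p | p.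
                  p \<in> carrier (mpoly_ring ({1..k} \<times> (UNIV :: 2 set) \<times> (UNIV :: 2 set)))},
     mult = (\<lambda>f g. \<lambda>A\<in>SL2_tuples k. f A * g A),
     one = (\<lambda>A\<in>SL2_tuples k. 1),
     zero = (\<lambda>A\<in>SL2_tuples k. 0),
     add = (\<lambda>f g. \<lambda>A\<in>SL2_tuples k. f A + g A)\<rparr>"

definition constant_functions :: "nat \<Rightarrow> ((nat \<Rightarrow> 'a::field ^ 2 ^ 2) \<Rightarrow> 'a) set" where
  "constant_functions k = range (\<lambda>c. \<lambda>A\<in>SL2_tuples k. c)"

definition trace_functions :: "nat \<Rightarrow> ((nat \<Rightarrow> 'a::field ^ 2 ^ 2) \<Rightarrow> 'a) set" where
  "trace_functions k =
    (\<lambda>g. \<lambda>A\<in>SL2_tuples k. trace (rep_of_tuple A g)) ` carrier (free_group k)"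

text \<open>The subalgebra generated by a set is the subring generated by it and the constants.
  (The locale \<open>subalgebra\<close> of HOL-Algebra does not require closure under products.)\<close>

definition coordinate_ring :: "nat \<Rightarrow> ((nat \<Rightarrow> 'a::field ^ 2 ^ 2) \<Rightarrow> 'a) ring" where
  "coordinate_ring k =
    (regular_ring k)\<lparr>carrier :=
      generate_ring (regular_ring k) (constant_functions k \<union> trace_functions k)\<rparr>"

section \<open>The parameters \<open>T\<close>\<close>

definition T_indices :: "nat \<Rightarrow> nat list set" where
  "T_indices k = {I. sorted_wrt (<) I \<and> set I \<subseteq> {1..k} \<and> length I \<in> {1, 2, 3}}"

definition T :: "nat list \<Rightarrow> (nat \<Rightarrow> 'a::field ^ 2 ^ 2) \<Rightarrow> 'a" where
  "T I A = trace (foldr (\<lambda>i M. A i ** M) I (mat 1))"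

definition T_coordinates :: "nat \<Rightarrow> (letter list \<Rightarrow> 'a) \<Rightarrow> nat list \<Rightarrow> 'a" where
  "T_coordinates k \<theta> = (\<lambda>I\<in>T_indices k. \<theta> (map (\<lambda>i. (i, True)) I))"

text \<open>A list \<open>[(i\<^sub>1, r\<^sub>1), \<dots>, (i\<^sub>m, r\<^sub>m)]\<close> encodes a monomial with integer exponents.\<close>

definition monomial_value :: "(nat \<Rightarrow> 'a::field ^ 2 ^ 2) \<Rightarrow> (nat \<times> int) list \<Rightarrow> 'a ^ 2 ^ 2" where
  "monomial_value A x = foldr (\<lambda>(i, r) M. (A i [^]\<^bsub>SL2\<^esub> r) ** M) x (mat 1)"

end

theory Submission
  imports Defs
begin

text \<open>Call a function on \<open>(SL\<^sub>2)\<^sup>k\<close> good if it is a polynomial in the \<open>T\<^sub>I\<close> with \<open>|I| \<le> 3\<close>. By the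
  polarised Cayley--Hamilton identity, exchanging two adjacent blocks \<open>X\<close>, \<open>Y\<close> in
  \<open>tr(XYZ)\<close> changes its sign modulo products of traces of shorter words. By induction on the
  length, whether the trace of a positive word is good therefore depends only on the multiset of
  its letters. A repeated letter can be moved next to its copy and removed by
  \<open>X\<^sup>2 = tr(X) X - 1\<close>; a word of at most three distinct letters can be sorted. In a word
  \<open>abcv\<close> with \<open>v\<close> nonempty, \<open>a\<close> passes \<open>bc\<close> in one exchange or in two, so \<open>2 tr(abcv)\<close> is good, which
  suffices when \<open>2\<close> is invertible; for \<open>k \<le> 3\<close> a word of length at least four has a repeated
  letter. Inverses are eliminated by \<open>X\<^sup>-\<^sup>1 = tr(X) - X\<close>.\<close>

section \<open>Polynomial functions\<close>

text \<open>Reduces identities that are additive in a polynomial to monomials: \<open>update\<close>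
  at a fresh key only adds one \<open>single\<close> term.\<close>

lemma poly_mapping_add_single_induct [case_names single add]:
  assumes "\<And>m c. P (Poly_Mapping.single m c)" and "\<And>p q. P p \<Longrightarrow> P q \<Longrightarrow> P (p + q)"
  shows "P (p :: 'm \<Rightarrow>\<^sub>0 'a::comm_monoid_add)"
proof (induction p rule: update_induct)
  case const
  show ?case using assms(1)[of undefined 0] by simp
next
  case (update p m c)
  have "Poly_Mapping.update m c p = Poly_Mapping.single m c + p"
    using update.hyps
    by (intro poly_mapping_eqI) (auto simp: lookup_update lookup_add lookup_single in_keys_iff)
  then show ?case using assms update.IH by metis
qed

definition monom_eval :: "('v \<Rightarrow> 'a::comm_ring_1) \<Rightarrow> ('v \<Rightarrow>\<^sub>0 nat) \<Rightarrow> 'a" where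
  "monom_eval f m = (\<Prod>v\<in>Poly_Mapping.keys m. f v ^ Poly_Mapping.lookup m v)"

text \<open>Variables outside the support have exponent 0, so two monomials can be compared over a
  common index set.\<close>

lemma monom_eval_superset:
  assumes "finite W" "Poly_Mapping.keys m \<subseteq> W"
  shows "monom_eval f m = (\<Prod>v\<in>W. f v ^ Poly_Mapping.lookup m v)"
  unfolding monom_eval_def
  using assms by (intro prod.mono_neutral_left) (auto simp: in_keys_iff)

lemma monom_eval_add: "monom_eval f (m + n) = monom_eval f m * monom_eval f n"
proof -
  let ?W = "Poly_Mapping.keys m \<union> Poly_Mapping.keys n"
  have "monom_eval f (m + n) = (\<Prod>v\<in>?W. f v ^ Poly_Mapping.lookup (m + n) v)"
    by (intro monom_eval_superset) (auto simp: keys_add)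
  also have "\<dots> = (\<Prod>v\<in>?W. f v ^ Poly_Mapping.lookup m v) * (\<Prod>v\<in>?W. f v ^ Poly_Mapping.lookup n v)"
    by (simp add: lookup_add power_add prod.distrib)
  also have "\<dots> = monom_eval f m * monom_eval f n"
    by (simp add: monom_eval_superset[of ?W])
  finally show ?thesis .
qed

lemma mpoly_eval_superset:
  assumes "finite M" "Poly_Mapping.keys p \<subseteq> M"
  shows "mpoly_eval f p = (\<Sum>m\<in>M. Poly_Mapping.lookup p m * monom_eval f m)"
  unfolding mpoly_eval_def monom_eval_def
  using assms by (intro sum.mono_neutral_left) (auto simp: in_keys_iff)

lemma mpoly_eval_single [simp]:
  "mpoly_eval f (Poly_Mapping.single m c) = c * monom_eval f m"
  by (subst mpoly_eval_superset[of "{m}"]) auto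

lemma mpoly_eval_1 [simp]: "mpoly_eval f 1 = 1"
  using mpoly_eval_single[of f 0 1] by (simp add: monom_eval_def)

lemma mpoly_eval_add [simp]: "mpoly_eval f (p + q) = mpoly_eval f p + mpoly_eval f q"
proof -
  let ?M = "Poly_Mapping.keys p \<union> Poly_Mapping.keys q"
  have "mpoly_eval f r = (\<Sum>m\<in>?M. Poly_Mapping.lookup r m * monom_eval f m)"
    if "Poly_Mapping.keys r \<subseteq> ?M" for r
    using that by (intro mpoly_eval_superset) auto
  then show ?thesis
    by (simp add: keys_add lookup_add algebra_simps sum.distrib)
qed

text \<open>Both sides are biadditive, which leaves products of two monomials, where exponents
  add.\<close>

lemma mpoly_eval_mult [simp]: "mpoly_eval f (p * q) = mpoly_eval f p * mpoly_eval f q"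
proof (induction p rule: poly_mapping_add_single_induct)
  case (single m c)
  show ?case
    by (induction q rule: poly_mapping_add_single_induct)
      (simp_all add: mult_single monom_eval_add algebra_simps)
next
  case (add p p')
  then show ?case by (simp add: algebra_simps)
qed

lemma mpoly_eval_cong:
  assumes "p \<in> carrier (mpoly_ring V)" "\<And>v. v \<in> V \<Longrightarrow> f v = g v"
  shows "mpoly_eval f p = mpoly_eval g p"
proof -
  have "f v = g v" if "m \<in> Poly_Mapping.keys p" "v \<in> Poly_Mapping.keys m" for m v
    using assms that by (auto simp: mpoly_ring_def)
  then show ?thesis by (simp add: mpoly_eval_def)
qed

lemma mpoly_carrier_add:
  "p \<in> carrier (mpoly_ring V) \<Longrightarrow> q \<in> carrier (mpoly_ring V) \<Longrightarrow> p + q \<in> carrier (mpoly_ring V)"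
  using keys_add[of p q] by (auto simp: mpoly_ring_def)

lemma mpoly_carrier_mult:
  assumes "p \<in> carrier (mpoly_ring V)" "q \<in> carrier (mpoly_ring V)"
  shows "p * q \<in> carrier (mpoly_ring V)"
proof -
  have "Poly_Mapping.keys m \<subseteq> V" if m: "m \<in> Poly_Mapping.keys (p * q)" for m
  proof -
    obtain a b where "m = a + b" "a \<in> Poly_Mapping.keys p" "b \<in> Poly_Mapping.keys q"
      using keys_mult[of p q] m by blast
    then show ?thesis
      using assms keys_add[of a b] by (fastforce simp: mpoly_ring_def)
  qed
  then show ?thesis by (simp add: mpoly_ring_def)
qed

lemma mpoly_carrier_uminus:
  "p \<in> carrier (mpoly_ring V) \<Longrightarrow> - p \<in> carrier (mpoly_ring V)"
  by (simp add: mpoly_ring_def)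

lemma mpoly_carrier_single:
  "Poly_Mapping.keys m \<subseteq> V \<Longrightarrow> Poly_Mapping.single m c \<in> carrier (mpoly_ring V)"
  by (simp add: mpoly_ring_def)

lemma ring_mpoly_ring: "ring (mpoly_ring V :: ('v, 'a::comm_ring_1) mpoly ring)"
proof (rule ringI)
  show "abelian_group (mpoly_ring V :: ('v, 'a) mpoly ring)"
  proof (rule abelian_groupI)
    fix p :: "('v, 'a) mpoly" assume "p \<in> carrier (mpoly_ring V)"
    then have "- p \<in> carrier (mpoly_ring V)" by (rule mpoly_carrier_uminus)
    then show "\<exists>q\<in>carrier (mpoly_ring V). q \<oplus>\<^bsub>mpoly_ring V\<^esub> p = \<zero>\<^bsub>mpoly_ring V\<^esub>"
      by (intro bexI[of _ "- p"]) (simp_all add: mpoly_ring_def)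
  next
    fix p q :: "('v, 'a) mpoly"
    assume "p \<in> carrier (mpoly_ring V)" "q \<in> carrier (mpoly_ring V)"
    then have "p + q \<in> carrier (mpoly_ring V)" by (rule mpoly_carrier_add)
    then show "p \<oplus>\<^bsub>mpoly_ring V\<^esub> q \<in> carrier (mpoly_ring V)"
      by (simp add: mpoly_ring_def)
  qed (simp_all add: mpoly_ring_def ac_simps)
  show "Group.monoid (mpoly_ring V :: ('v, 'a) mpoly ring)"
  proof (rule monoidI)
    fix p q :: "('v, 'a) mpoly"
    assume "p \<in> carrier (mpoly_ring V)" "q \<in> carrier (mpoly_ring V)"
    then have "p * q \<in> carrier (mpoly_ring V)" by (rule mpoly_carrier_mult)
    then show "p \<otimes>\<^bsub>mpoly_ring V\<^esub> q \<in> carrier (mpoly_ring V)"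
      by (simp add: mpoly_ring_def)
  qed (simp_all add: mpoly_ring_def ac_simps)
qed (simp_all add: mpoly_ring_def algebra_simps)

text \<open>Only the values on \<open>S\<close> matter, so membership is insensitive to how a
  function is extended beyond \<open>S\<close>. The coordinates \<open>x\<close> will be the traces
  \<open>T\<close>, later also the matrix entries.\<close>

definition poly_funs :: "'b set \<Rightarrow> ('b \<Rightarrow> 'v \<Rightarrow> 'a::comm_ring_1) \<Rightarrow> 'v set \<Rightarrow> ('b \<Rightarrow> 'a) set" where
  "poly_funs S x V = {f. \<exists>p\<in>carrier (mpoly_ring V). \<forall>A\<in>S. f A = mpoly_eval (x A) p}"

lemma poly_funs_eqI:
  "g \<in> poly_funs S x V \<Longrightarrow> (\<And>A. A \<in> S \<Longrightarrow> f A = g A) \<Longrightarrow> f \<in> poly_funs S x V"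
  by (auto simp: poly_funs_def)

lemma poly_funs_restrict: "f \<in> poly_funs S x V \<Longrightarrow> restrict f S \<in> poly_funs S x V"
  by (rule poly_funs_eqI) auto

lemma poly_funs_const: "(\<lambda>A. c) \<in> poly_funs S x V"
  unfolding poly_funs_def
  by (auto intro!: bexI[of _ "Poly_Mapping.single 0 c"] mpoly_carrier_single simp: monom_eval_def)

lemma poly_funs_coord:
  assumes "v \<in> V"
  shows "(\<lambda>A. x A v) \<in> poly_funs S x V"
proof -
  let ?p = "Poly_Mapping.single (Poly_Mapping.single v 1) 1"
  have "?p \<in> carrier (mpoly_ring V)"
    using assms by (intro mpoly_carrier_single) simp
  moreover have "mpoly_eval (x A) ?p = x A v" for A
    by (simp add: monom_eval_def)
  ultimately show ?thesis unfolding poly_funs_def by (intro CollectI bexI[of _ ?p]) simp_all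
qed

lemma poly_funs_add:
  assumes "f \<in> poly_funs S x V" "g \<in> poly_funs S x V"
  shows "(\<lambda>A. f A + g A) \<in> poly_funs S x V"
proof -
  from assms obtain p q where "p \<in> carrier (mpoly_ring V)" "\<And>A. A \<in> S \<Longrightarrow> f A = mpoly_eval (x A) p"
    "q \<in> carrier (mpoly_ring V)" "\<And>A. A \<in> S \<Longrightarrow> g A = mpoly_eval (x A) q"
    by (auto simp: poly_funs_def)
  then show ?thesis
    unfolding poly_funs_def by (auto intro!: bexI[of _ "p + q"] mpoly_carrier_add)
qed

lemma poly_funs_mult:
  assumes "f \<in> poly_funs S x V" "g \<in> poly_funs S x V"
  shows "(\<lambda>A. f A * g A) \<in> poly_funs S x V"
proof -
  from assms obtain p q where "p \<in> carrier (mpoly_ring V)" "\<And>A. A \<in> S \<Longrightarrow> f A = mpoly_eval (x A) p"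
    "q \<in> carrier (mpoly_ring V)" "\<And>A. A \<in> S \<Longrightarrow> g A = mpoly_eval (x A) q"
    by (auto simp: poly_funs_def)
  then show ?thesis
    unfolding poly_funs_def by (auto intro!: bexI[of _ "p * q"] mpoly_carrier_mult)
qed

lemma poly_funs_uminus:
  "f \<in> poly_funs S x V \<Longrightarrow> (\<lambda>A. - f A) \<in> poly_funs S x V"
  using poly_funs_mult[OF poly_funs_const[of "- 1"], of f S x V] by simp

lemma poly_funs_diff:
  "f \<in> poly_funs S x V \<Longrightarrow> g \<in> poly_funs S x V \<Longrightarrow> (\<lambda>A. f A - g A) \<in> poly_funs S x V"
  using poly_funs_add[OF _ poly_funs_uminus, of f S x V g] by simp

lemmas poly_funs_intros =
  poly_funs_const poly_funs_add poly_funs_mult poly_funs_uminus poly_funs_diff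

section \<open>Trace identities for two by two matrices\<close>

lemma matrix_mult_2:
  "((A :: 'a::comm_ring_1^2^2) ** B) $ i $ j = A $ i $ 1 * B $ 1 $ j + A $ i $ 2 * B $ 2 $ j"
  by (simp add: matrix_matrix_mult_def sum_2)

lemma trace_2: "trace (A :: 'a::comm_ring_1^2^2) = A $ 1 $ 1 + A $ 2 $ 2"
  by (simp add: trace_def sum_2)

text \<open>The polarised Cayley--Hamilton identity, multiplied by \<open>Z\<close> and traced.\<close>

lemma trace_mult_swap:
  fixes X Y Z :: "'a::comm_ring_1^2^2"
  shows "trace (X ** Y ** Z) = trace X * trace (Y ** Z) + trace Y * trace (X ** Z)
    + (trace (X ** Y) - trace X * trace Y) * trace Z - trace (Y ** X ** Z)"
  unfolding trace_2 matrix_mult_2 by (simp add: algebra_simps)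

lemma trace_square_mult:
  fixes X Z :: "'a::comm_ring_1^2^2"
  assumes "det X = 1"
  shows "trace (X ** X ** Z) = trace X * trace (X ** Z) - trace Z"
proof -
  have "trace (X ** X ** Z) = trace X * trace (X ** Z) - det X * trace Z"
    unfolding trace_2 matrix_mult_2 det_2 by (simp add: algebra_simps)
  with assms show ?thesis by simp
qed

text \<open>Put the inverse of \<open>X\<close> times \<open>Z\<close> in place of \<open>Z\<close>
  in the square identity: the left side collapses to the trace of \<open>X ** Z\<close>.\<close>

lemma trace_SL2_inv_mult:
  fixes X Z :: "'a::field^2^2"
  assumes "X \<in> carrier SL2"
  shows "trace (inv\<^bsub>SL2\<^esub> X ** Z) = trace X * trace Z - trace (X ** Z)"
proof -
  interpret group "SL2 :: ('a^2^2) monoid" by (rule group_SL2)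
  have X: "X ** inv\<^bsub>SL2\<^esub> X = mat 1"
    using r_inv[OF assms] by (simp add: SL2_def)
  have "det X = 1" using assms by (simp add: SL2_def)
  from trace_square_mult[OF this, of "inv\<^bsub>SL2\<^esub> X ** Z"] show ?thesis
    by (simp add: matrix_mul_assoc X flip: matrix_mul_assoc[of X X "inv\<^bsub>SL2\<^esub> X"])
qed

section \<open>Traces of positive words\<close>

definition word_prod :: "(nat \<Rightarrow> 'a::field^2^2) \<Rightarrow> nat list \<Rightarrow> 'a^2^2" where
  "word_prod A w = foldr (\<lambda>i M. A i ** M) w (mat 1)"

lemma word_prod_simps [simp]:
  "word_prod A [] = mat 1" "word_prod A (i # w) = A i ** word_prod A w"
  by (simp_all add: word_prod_def)

lemma word_prod_append: "word_prod A (u @ v) = word_prod A u ** word_prod A v"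
  by (induction u) (simp_all add: matrix_mul_assoc)

lemma T_eq: "T w A = trace (word_prod A w)"
  by (simp add: T_def word_prod_def)

lemma T_rotate: "T (u @ v) A = T (v @ u) A"
  unfolding T_eq word_prod_append by (rule trace_mul_sym)

lemma T_swap:
  "T (x @ y @ w) A = T x A * T (y @ w) A + T y A * T (x @ w) A
    + (T (x @ y) A - T x A * T y A) * T w A - T (y @ x @ w) A"
  using trace_mult_swap[of "word_prod A x" "word_prod A y" "word_prod A w"]
  by (simp add: T_eq word_prod_append matrix_mul_assoc)

lemma T_repeat:
  "det (A i) = 1 \<Longrightarrow> T (i # i # w) A = T [i] A * T (i # w) A - T w A"
  using trace_square_mult[of "A i" "word_prod A w"] by (simp add: T_eq matrix_mul_assoc)

text \<open>The first letter of \<open>ys\<close> is located in \<open>xs\<close> and bubbled to the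
  front; the remaining letters follow behind a growing fixed prefix \<open>u\<close>.\<close>

lemma perm_adjacent_swap_induct:
  assumes swap: "\<And>u a b v. P (u @ a # b # v) \<Longrightarrow> P (u @ b # a # v)"
    and P: "P xs" and mset: "mset xs = mset ys"
  shows "P ys"
proof -
  have move: "P (u @ s @ y # t) \<Longrightarrow> P (u @ y # s @ t)" for u s y t
  proof (induction s arbitrary: t rule: rev_induct)
    case (snoc a s)
    then show ?case using swap[of "u @ s" a y t] by simp
  qed simp
  have "P (u @ xs) \<Longrightarrow> mset xs = mset ys \<Longrightarrow> P (u @ ys)" for u
  proof (induction ys arbitrary: u xs)
    case (Cons y ys)
    then have "y \<in> set xs" by (metis list.set_intros(1) set_mset_mset)
    then obtain s t where xs: "xs = s @ y # t" by (meson split_list)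
    then show ?case
      using Cons.IH[of "u @ [y]" "s @ t"] move[of u s y t] Cons.prems by simp
  qed simp
  from this[of "[]"] P mset show ?thesis by simp
qed

text \<open>These are the good functions of the overview.\<close>

abbreviation T_polys :: "nat \<Rightarrow> ((nat \<Rightarrow> 'a::field^2^2) \<Rightarrow> 'a) set" where
  "T_polys k \<equiv> poly_funs (SL2_tuples k) (\<lambda>A I. T I A) (T_indices k)"

lemma SL2_tuples_det: "A \<in> SL2_tuples k \<Longrightarrow> i \<in> {1..k} \<Longrightarrow> det (A i) = 1"
  by (auto simp: SL2_tuples_def SL2_def)

text \<open>\<open>IH\<close> is the induction hypothesis on length, passed in from outside: an
  exchange of neighbours negates the trace up to products of traces of shorter words.\<close>

lemma T_polys_perm:
  fixes w :: "nat list"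
  assumes IH: "\<And>v. length v < length w \<Longrightarrow> set v \<subseteq> {1..k} \<Longrightarrow>
      T v \<in> (T_polys k :: ((nat \<Rightarrow> 'a::field^2^2) \<Rightarrow> 'a) set)"
    and w: "set w \<subseteq> {1..k}" and mset: "mset w = mset w'"
    and w': "T w' \<in> (T_polys k :: ((nat \<Rightarrow> 'a^2^2) \<Rightarrow> 'a) set)"
  shows "T w \<in> (T_polys k :: ((nat \<Rightarrow> 'a^2^2) \<Rightarrow> 'a) set)"
proof -
  let ?R = "T_polys k :: ((nat \<Rightarrow> 'a^2^2) \<Rightarrow> 'a) set"
  \<comment> \<open>Carrying the multiset along preserves length and letters, so that the words in
    the exchange identity count as shorter than \<open>w\<close>.\<close>
  let ?P = "\<lambda>v. mset v = mset w \<and> T v \<in> ?R"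
  have shorter: "T v \<in> ?R" if "length v < length w" "set v \<subseteq> set w" for v
    using that w by (intro IH) auto
  have "?P w"
  proof (rule perm_adjacent_swap_induct[of ?P w' w])
    fix u a b v assume P: "?P (u @ a # b # v)"
    have len: "length (u @ a # b # v) = length w" and sets: "set (u @ a # b # v) = set w"
      using P mset_eq_length mset_eq_setD by blast+
    \<comment> \<open>By cyclicity the pair may be assumed to stand at the front.\<close>
    have rot: "T (u @ c # d # v) = (T (c # d # v @ u) :: (nat \<Rightarrow> 'a^2^2) \<Rightarrow> 'a)" for c d
      using T_rotate[of u "c # d # v"] by auto
    have "T (b # a # v @ u) \<in> ?R"
    \<comment> \<open>For a two-letter word the exchange identity would contain a trace of the same
      length; there cyclicity alone swaps the letters.\<close>
    proof (cases "v @ u = []")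
      case True
      then have "T (u @ a # b # v) = (T (b # a # v @ u) :: (nat \<Rightarrow> 'a^2^2) \<Rightarrow> 'a)"
        using T_rotate[of "[a]" "[b]"] by auto
      then show ?thesis using P by simp
    next
      case False
      then have "0 < length v + length u" by auto
      then have "T [b] \<in> ?R" "T [a] \<in> ?R" "T (v @ u) \<in> ?R" "T (b # v @ u) \<in> ?R"
        "T (a # v @ u) \<in> ?R" "T [b, a] \<in> ?R"
        by (intro shorter; force simp: len[symmetric] sets[symmetric])+
      then show ?thesis
        by (intro poly_funs_eqI[OF _ T_swap[of "[b]" "[a]" "v @ u", simplified]] poly_funs_diff
            poly_funs_add poly_funs_mult) (use P rot in simp_all)
    qed
    then show "?P (u @ b # a # v)" using P unfolding rot by (auto simp: add_mset_commute)
  qed (use mset w' in auto)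
  then show ?thesis by simp
qed

text \<open>The disjunction in \<open>char\<close> arises because the argument divides by 2 only for
  words of four or more distinct letters, and these do not exist when k <= 3.\<close>

lemma T_in_T_polys:
  assumes char: "CHAR('a::field) \<noteq> 2 \<or> k \<le> 3" and w: "set w \<subseteq> {1..k}"
  shows "T w \<in> (T_polys k :: ((nat \<Rightarrow> 'a^2^2) \<Rightarrow> 'a) set)"
  using w
proof (induction "length w" arbitrary: w rule: less_induct)
  case less
  let ?R = "T_polys k :: ((nat \<Rightarrow> 'a^2^2) \<Rightarrow> 'a) set"
  have perm: "T w \<in> ?R" if "mset w = mset v" "T v \<in> ?R" for v
    using T_polys_perm[OF less.hyps less.prems that] .
  have shorter: "T v \<in> ?R" if "length v < length w" "set v \<subseteq> set w" for v
    using that less.prems by (intro less.hyps) auto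
  show ?case
  proof (cases "distinct w")
    case False
    then obtain xs ys zs i where "w = xs @ [i] @ ys @ [i] @ zs"
      using not_distinct_decomp by blast
    \<comment> \<open>By \<open>perm\<close> the two copies of \<open>i\<close> may be placed side
      by side, where the square can be reduced.\<close>
    then have w: "mset w = mset (i # i # xs @ ys @ zs)" by simp
    from w have len: "length w = length (i # i # xs @ ys @ zs)"
      and sets: "set w = set (i # i # xs @ ys @ zs)"
      using mset_eq_length mset_eq_setD by blast+
    show ?thesis
    proof (rule perm[OF w])
      have "T [i] \<in> ?R" "T (i # xs @ ys @ zs) \<in> ?R" "T (xs @ ys @ zs) \<in> ?R"
        by (intro shorter; force simp: len sets)+
      then have "(\<lambda>A. T [i] A * T (i # xs @ ys @ zs) A - T (xs @ ys @ zs) A) \<in> ?R"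
        by (intro poly_funs_diff poly_funs_mult)
      moreover have "i \<in> {1..k}" using sets less.prems by auto
      ultimately show "T (i # i # xs @ ys @ zs) \<in> ?R"
        by (elim poly_funs_eqI) (intro T_repeat SL2_tuples_det)
    qed
  next
    case distinct: True
    show ?thesis
    proof (cases "length w \<le> 3")
      case short: True
      show ?thesis
      proof (cases "w = []")
        case True
        \<comment> \<open>The empty list is not an index in \<open>T_indices\<close>, but its trace
          is a constant.\<close>
        then have "T w = (\<lambda>A :: nat \<Rightarrow> 'a^2^2. trace (mat 1 :: 'a^2^2))"
          by (simp add: T_eq[abs_def])
        then show ?thesis by (simp add: poly_funs_const)
      next
        case False
        then have "0 < length w" by simp
        then have "length w = 1 \<or> length w = 2 \<or> length w = 3" using short by linarith
        then have "sort w \<in> T_indices k"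
          using distinct less.prems by (auto simp: T_indices_def strict_sorted_iff)
        then have "T (sort w) \<in> ?R" by (rule poly_funs_coord)
        then show ?thesis by (intro perm[of "sort w"]) auto
      qed
    next
      case long: False
      have "card (set w) \<le> k" using card_mono[OF _ less.prems] by simp
      then have "\<not> k \<le> 3" using distinct_card[OF distinct] long by simp
      with char have "CHAR('a) \<noteq> 2" by simp
      \<comment> \<open>A characteristic dividing 2 would be 1 or 2; a field excludes 1.\<close>
      then have "\<not> CHAR('a) dvd 2"
        using CHAR_not_1[where 'a = 'a] prime_nat_iff[of 2] by auto
      then have two: "(2 :: 'a) \<noteq> 0"
        using of_nat_eq_0_iff_char_dvd[of 2, where 'a = 'a] by simp
      from long obtain a b c v where w: "w = a # b # c # v" and v: "v \<noteq> []"
        by (cases w rule: remdups_adj.cases; cases "tl (tl w)"; cases "tl (tl (tl w))") auto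
      \<comment> \<open>By \<open>T_swap\<close>, \<open>?s x y u\<close> is the sum of the traces
        of \<open>x @ y @ u\<close> and \<open>y @ x @ u\<close>.\<close>
      let ?s = "\<lambda>x y u A. T x A * T (y @ u) A + T y A * T (x @ u) A
        + (T (x @ y) A - T x A * T y A) * T u A :: 'a"
      \<comment> \<open>Nonempty blocks make every word occurring in \<open>?s\<close> strictly
        shorter than \<open>w\<close>.\<close>
      have s: "?s x y u \<in> ?R"
        if "mset w = mset (x @ y @ u)" "x \<noteq> []" "y \<noteq> []" "u \<noteq> []" for x y u
      proof -
        have "length w = length (x @ y @ u)" "set w = set (x @ y @ u)"
          using that(1) mset_eq_length mset_eq_setD by blast+
        moreover have "0 < length x" "0 < length y" "0 < length u" using that by auto
        ultimately have "T x \<in> ?R" "T y \<in> ?R" "T u \<in> ?R" "T (x @ y) \<in> ?R"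
            "T (x @ u) \<in> ?R" "T (y @ u) \<in> ?R"
          by (intro shorter; force)+
        then show ?thesis by (intro poly_funs_intros)
      qed
      \<comment> \<open>Moving \<open>a\<close> past \<open>b\<close> and then past \<open>c\<close>
        changes the sign twice, moving it past the block \<open>[b, c]\<close> changes it once;
        adding both expressions cancels the trace of \<open>b # c # a # v\<close>.\<close>
      have "T w A = inverse 2 *
          (?s [a] [b] (c # v) A - ?s [a] [c] (v @ [b]) A + ?s [a] [b, c] v A)" for A
      proof -
        have "T w A = ?s [a] [b] (c # v) A - T (b # a # c # v) A"
          using T_swap[of "[a]" "[b]" "c # v" A] by (simp add: w)
        \<comment> \<open>The exchange of \<open>a\<close> and \<open>c\<close> happens behind
          \<open>b\<close>, so \<open>b\<close> is rotated to the end and back.\<close>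
        moreover have "T (b # a # c # v) A = ?s [a] [c] (v @ [b]) A - T (b # c # a # v) A"
          using T_swap[of "[a]" "[c]" "v @ [b]" A] T_rotate[of "[b]" "a # c # v" A]
            T_rotate[of "[b]" "c # a # v" A] by simp
        moreover have "T w A = ?s [a] [b, c] v A - T (b # c # a # v) A"
          using T_swap[of "[a]" "[b, c]" v A] by (simp add: w)
        \<comment> \<open>Here \<open>y\<close> stands for the trace of \<open>b # a # c # v\<close>
          and \<open>z\<close> for that of \<open>b # c # a # v\<close>.\<close>
        moreover have "x = inverse 2 * (p - q + r)"
          if "x = p - y" "y = q - z" "x = r - z" for x y z p q r :: 'a
        proof -
          have "x + x = (p - y) + (r - z)" using that(1,3) by (rule arg_cong2)
          then have "2 * x = p - q + r" by (simp add: that(2))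
          with two show ?thesis by (simp add: field_simps)
        qed
        ultimately show ?thesis by blast
      qed
      moreover have "(\<lambda>A. inverse 2 *
          (?s [a] [b] (c # v) A - ?s [a] [c] (v @ [b]) A + ?s [a] [b, c] v A)) \<in> ?R"
        using v by (intro poly_funs_mult[OF poly_funs_const poly_funs_add[OF poly_funs_diff[OF s s] s]])
          (simp_all add: w)
      ultimately show ?thesis by (rule poly_funs_eqI[rotated])
    qed
  qed
qed

section \<open>Traces of arbitrary words\<close>

lemma rep_of_tuple_Nil [simp]: "rep_of_tuple A [] = mat 1"
  by (simp add: rep_of_tuple_def SL2_def)

lemma rep_of_tuple_Cons [simp]:
  "rep_of_tuple A ((i, e) # w) = (if e then A i else inv\<^bsub>SL2\<^esub> (A i)) ** rep_of_tuple A w"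
  by (simp add: rep_of_tuple_def SL2_def)

lemma rep_of_tuple_append:
  "rep_of_tuple A (u @ v) = rep_of_tuple A u ** rep_of_tuple A v"
  by (induction u) (auto simp: matrix_mul_assoc)

lemma rep_of_tuple_positive: "rep_of_tuple A (map (\<lambda>i. (i, True)) w) = word_prod A w"
  by (induction w) auto

text \<open>The prefix \<open>u\<close> absorbs the letters already freed of inverses.\<close>

lemma trace_word_prod_rep_of_tuple:
  assumes char: "CHAR('a::field) \<noteq> 2 \<or> k \<le> 3"
    and "set u \<subseteq> {1..k}" "fst ` set w \<subseteq> {1..k}"
  shows "(\<lambda>A. trace (word_prod A u ** rep_of_tuple A w))
    \<in> (T_polys k :: ((nat \<Rightarrow> 'a^2^2) \<Rightarrow> 'a) set)"
  using assms(2,3)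
proof (induction w arbitrary: u)
  case Nil
  then show ?case using T_in_T_polys[OF char, of u] by (simp add: T_eq[abs_def])
next
  case (Cons a w)
  obtain i e where a: "a = (i, e)" by (cases a)
  have i: "i \<in> {1..k}" and w: "fst ` set w \<subseteq> {1..k}" using Cons.prems a by auto
  \<comment> \<open>The positive letter joins the prefix; the same trace occurs when an inverse is
    expanded.\<close>
  have pos: "(\<lambda>A. trace (word_prod A u ** (A i ** rep_of_tuple A w)))
      \<in> (T_polys k :: ((nat \<Rightarrow> 'a^2^2) \<Rightarrow> 'a) set)"
    using Cons.IH[of "u @ [i]"] i w Cons.prems by (simp add: word_prod_append matrix_mul_assoc)
  show ?case
  proof (cases e)
    case True
    then show ?thesis using pos a by simp
  next
    case False
    have "trace (word_prod A u ** rep_of_tuple A (a # w))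
      = T [i] A * trace (word_prod A u ** rep_of_tuple A w)
        - trace (word_prod A u ** (A i ** rep_of_tuple A w))"
      if A: "A \<in> SL2_tuples k" for A :: "nat \<Rightarrow> 'a^2^2"
    proof -
      have "A i \<in> carrier SL2" using A i by (auto simp: SL2_tuples_def)
      \<comment> \<open>Cyclicity brings the inverse letter to the front, with \<open>u\<close>
        behind \<open>w\<close>.\<close>
      from trace_SL2_inv_mult[OF this, of "rep_of_tuple A w ** word_prod A u"]
      show ?thesis using False
        by (simp add: a T_eq trace_mul_sym[of "word_prod A u"] flip: matrix_mul_assoc)
    qed
    moreover have "(\<lambda>A. T [i] A * trace (word_prod A u ** rep_of_tuple A w)
        - trace (word_prod A u ** (A i ** rep_of_tuple A w)))
      \<in> (T_polys k :: ((nat \<Rightarrow> 'a^2^2) \<Rightarrow> 'a) set)"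
      using Cons.IH[of u] Cons.prems(1) w pos i T_in_T_polys[OF char, of "[i]"]
      by (intro poly_funs_mult poly_funs_diff) auto
    ultimately show ?thesis by (rule poly_funs_eqI[rotated])
  qed
qed

lemma trace_rep_of_tuple:
  assumes "CHAR('a::field) \<noteq> 2 \<or> k \<le> 3" "fst ` set w \<subseteq> {1..k}"
  shows "(\<lambda>A. trace (rep_of_tuple A w)) \<in> (T_polys k :: ((nat \<Rightarrow> 'a^2^2) \<Rightarrow> 'a) set)"
  using trace_word_prod_rep_of_tuple[OF assms(1) _ assms(2), of "[]"] by simp

text \<open>Turns integer exponents into runs of one letter, so that monomials become words;
  exponent 0 gives the empty word.\<close>

lemma SL2_int_pow_eq_rep_of_tuple:
  assumes "A i \<in> carrier SL2"
  shows "A i [^]\<^bsub>SL2\<^esub> r = rep_of_tuple A (replicate (nat \<bar>r\<bar>) (i, 0 \<le> r))"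
proof -
  interpret group SL2 by (rule group_SL2)
  have pow: "rep_of_tuple A (replicate n (i, e)) = (if e then A i else inv\<^bsub>SL2\<^esub> (A i)) [^]\<^bsub>SL2\<^esub> n"
    for n :: nat and e
  proof (induction n)
    case 0
    then show ?case by (simp add: SL2_def)
  next
    case (Suc n)
    have "rep_of_tuple A (replicate (Suc n) (i, e))
        = (if e then A i else inv\<^bsub>SL2\<^esub> (A i)) \<otimes>\<^bsub>SL2\<^esub> rep_of_tuple A (replicate n (i, e))"
      by (simp add: SL2_def)
    then show ?case
      using assms unfolding Suc by (simp add: nat_pow_Suc2[symmetric] del: nat_pow_Suc)
  qed
  show ?thesis
  proof (cases "0 \<le> r")
    case True
    then show ?thesis unfolding pow int_pow_def2 by simp
  next
    case False
    then have "nat \<bar>r\<bar> = nat (- r)" by simp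
    then show ?thesis
      using False nat_pow_inv[OF assms, of "nat (- r)"] unfolding pow int_pow_def2 by simp
  qed
qed

text \<open>The resulting word may fail to be reduced, which is harmless:
  \<open>trace_rep_of_tuple\<close> accepts every word in the allowed letters.\<close>

lemma monomial_value_eq_rep_of_tuple:
  assumes "A \<in> SL2_tuples k" "fst ` set x \<subseteq> {1..k}"
  shows "monomial_value A x
    = rep_of_tuple A (concat (map (\<lambda>(i, r). replicate (nat \<bar>r\<bar>) (i, 0 \<le> r)) x))"
  using assms(2)
proof (induction x)
  case Nil
  then show ?case by (simp add: monomial_value_def)
next
  case (Cons a x)
  obtain i r where a: "a = (i, r)" by (cases a)
  have "A i \<in> carrier SL2" using assms(1) Cons.prems a by (auto simp: SL2_tuples_def)
  then show ?case
    using Cons SL2_int_pow_eq_rep_of_tuple[of A i r]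
    by (simp add: monomial_value_def a rep_of_tuple_append)
qed

lemma trace_monomial_value:
  assumes "CHAR('a::field) \<noteq> 2 \<or> k \<le> 3" "fst ` set x \<subseteq> {1..k}"
  shows "(\<lambda>A. trace (monomial_value A x)) \<in> (T_polys k :: ((nat \<Rightarrow> 'a^2^2) \<Rightarrow> 'a) set)"
proof (rule poly_funs_eqI)
  show "(\<lambda>A. trace (rep_of_tuple A (concat (map (\<lambda>(i, r). replicate (nat \<bar>r\<bar>) (i, 0 \<le> r)) x))))
      \<in> (T_polys k :: ((nat \<Rightarrow> 'a^2^2) \<Rightarrow> 'a) set)"
    using assms(2) by (intro trace_rep_of_tuple[OF assms(1)]) (fastforce split: if_splits)
qed (simp add: monomial_value_eq_rep_of_tuple[OF _ assms(2)])

section \<open>The coordinate ring\<close>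

lemma positive_word_in_free_group:
  "set w \<subseteq> {1..k} \<Longrightarrow> map (\<lambda>i. (i, True)) w \<in> carrier (free_group k)"
  \<comment> \<open>A word without inverse letters admits no cancellation, so it is already
    reduced.\<close>
  by (auto simp: free_group_def reduced_def successively_map inv_letter_def)
     (simp add: successively_conv_nth)

text \<open>The value of a character at \<open>w\<close> is a polynomial in its trace coordinates,
  and this polynomial depends on \<open>w\<close> but not on the representation.\<close>

lemma inj_on_T_coordinates:
  assumes char: "CHAR('a::field) \<noteq> 2 \<or> k \<le> 3"
  shows "inj_on (T_coordinates k) (character_variety k :: (letter list \<Rightarrow> 'a) set)"
proof (rule inj_onI)
  fix \<theta> \<theta>' :: "letter list \<Rightarrow> 'a"
  assume "\<theta> \<in> character_variety k" "\<theta>' \<in> character_variety k"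
  then obtain \<rho> \<rho>' :: "letter list \<Rightarrow> 'a^2^2" where \<rho>: "\<rho> \<in> hom (free_group k) SL2" "\<theta> = character k \<rho>"
    and \<rho>': "\<rho>' \<in> hom (free_group k) SL2" "\<theta>' = character k \<rho>'"
    by (auto simp: character_variety_def)
  assume eq: "T_coordinates k \<theta> = T_coordinates k \<theta>'"
  define A where "A = (\<lambda>\<rho> :: letter list \<Rightarrow> 'a^2^2. \<lambda>i\<in>{1..k}. \<rho> [(i, True)])"
  have A: "A \<rho> \<in> SL2_tuples k" if "\<rho> \<in> hom (free_group k) SL2" for \<rho>
    using that positive_word_in_free_group[of "[_]" k] unfolding A_def SL2_tuples_def hom_def by auto
  have tr: "character k \<rho> w = trace (rep_of_tuple (A \<rho>) w)"
    if "\<rho> \<in> hom (free_group k) SL2" "w \<in> carrier (free_group k)" for \<rho> w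
    using hom_eq_rep_of_tuple[OF that] that(2) by (simp add: character_def A_def)
  have T: "T I (A \<rho>) = T_coordinates k (character k \<rho>) I"
    if "\<rho> \<in> hom (free_group k) SL2" "I \<in> T_indices k" for \<rho> I
  proof -
    have "map (\<lambda>i. (i, True)) I \<in> carrier (free_group k)"
      using that(2) by (intro positive_word_in_free_group) (simp add: T_indices_def)
    then show ?thesis
      using that by (simp add: T_coordinates_def tr T_eq rep_of_tuple_positive)
  qed
  show "\<theta> = \<theta>'"
  proof
    fix w
    show "\<theta> w = \<theta>' w"
    proof (cases "w \<in> carrier (free_group k)")
      case True
      then have "fst ` set w \<subseteq> {1..k}" by (simp add: free_group_def)
      from trace_rep_of_tuple[OF char this]
      obtain p where p: "p \<in> carrier (mpoly_ring (T_indices k))"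
        and tr_p: "\<And>A :: nat \<Rightarrow> 'a^2^2. A \<in> SL2_tuples k \<Longrightarrow>
          trace (rep_of_tuple A w) = mpoly_eval (\<lambda>I. T I A) p"
        by (auto simp: poly_funs_def)
      have "mpoly_eval (\<lambda>I. T I (A \<rho>)) p = mpoly_eval (\<lambda>I. T I (A \<rho>')) p"
        using eq \<rho> \<rho>' by (intro mpoly_eval_cong[OF p]) (simp add: T)
      then show ?thesis
        using True \<rho> \<rho>' by (simp add: tr tr_p A)
    \<comment> \<open>Outside the free group both characters take the default value of a restricted
      function.\<close>
    qed (simp add: \<rho> \<rho>' character_def)
  qed
qed

section \<open>Regular functions on tuples of matrices\<close>

abbreviation entry_polys :: "nat \<Rightarrow> ((nat \<Rightarrow> 'a::field^2^2) \<Rightarrow> 'a) set" where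
  "entry_polys k \<equiv>
    poly_funs (SL2_tuples k) (\<lambda>A (i, r, c). A i $ r $ c) ({1..k} \<times> UNIV \<times> UNIV)"

lemma regular_ring_carrier:
  "f \<in> carrier (regular_ring k) \<longleftrightarrow> f \<in> extensional (SL2_tuples k) \<and> f \<in> entry_polys k"
  (is "_ \<longleftrightarrow> ?R f")
proof
  assume "?R f"
  then obtain p where "p \<in> carrier (mpoly_ring ({1..k} \<times> UNIV \<times> UNIV))"
    and "\<And>A. A \<in> SL2_tuples k \<Longrightarrow> f A = mpoly_eval (\<lambda>(i, r, c). A i $ r $ c) p"
    by (auto simp: poly_funs_def)
  moreover from this \<open>?R f\<close> have "f = (\<lambda>A\<in>SL2_tuples k. mpoly_eval (\<lambda>(i, r, c). A i $ r $ c) p)"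
    by (intro extensionalityI[of f "SL2_tuples k"]) auto
  ultimately show "f \<in> carrier (regular_ring k)"
    by (auto simp: regular_ring_def)
qed (auto simp: regular_ring_def poly_funs_def)

lemma restrict_in_regular_ring:
  "f \<in> entry_polys k \<Longrightarrow> restrict f (SL2_tuples k) \<in> carrier (regular_ring k)"
  unfolding regular_ring_carrier by (simp add: poly_funs_restrict)

lemma ring_regular_ring: "ring (regular_ring k :: ((nat \<Rightarrow> 'a::field^2^2) \<Rightarrow> 'a) ring)"
proof -
  let ?R = "regular_ring k :: ((nat \<Rightarrow> 'a::field^2^2) \<Rightarrow> 'a) ring"
  have ops: "f \<oplus>\<^bsub>?R\<^esub> g = (\<lambda>A\<in>SL2_tuples k. f A + g A)"
    "f \<otimes>\<^bsub>?R\<^esub> g = (\<lambda>A\<in>SL2_tuples k. f A * g A)"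
    "\<zero>\<^bsub>?R\<^esub> = (\<lambda>A\<in>SL2_tuples k. 0)" "\<one>\<^bsub>?R\<^esub> = (\<lambda>A\<in>SL2_tuples k. 1)" for f g
    by (simp_all add: regular_ring_def)
  have closed: "f \<oplus>\<^bsub>?R\<^esub> g \<in> carrier ?R" "f \<otimes>\<^bsub>?R\<^esub> g \<in> carrier ?R"
    if "f \<in> carrier ?R" "g \<in> carrier ?R" for f g
    using that unfolding ops regular_ring_carrier[of f] regular_ring_carrier[of g]
    by (intro restrict_in_regular_ring poly_funs_intros; simp)+
  have const_closed: "\<zero>\<^bsub>?R\<^esub> \<in> carrier ?R" "\<one>\<^bsub>?R\<^esub> \<in> carrier ?R"
    unfolding ops by (intro restrict_in_regular_ring poly_funs_intros)+
  \<comment> \<open>The neutral laws are equalities of functions because carrier elements are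
    extensional.\<close>
  have ext: "restrict f (SL2_tuples k) = f" if "f \<in> carrier ?R" for f
    using that by (simp add: regular_ring_carrier extensional_restrict)
  show ?thesis
  proof (rule ringI)
    show "abelian_group ?R"
    proof (rule abelian_groupI)
      fix f assume f: "f \<in> carrier ?R"
      then have "(\<lambda>A\<in>SL2_tuples k. - f A) \<in> carrier ?R"
        unfolding regular_ring_carrier[of f] by (intro restrict_in_regular_ring poly_funs_intros) simp
      then show "\<exists>g\<in>carrier ?R. g \<oplus>\<^bsub>?R\<^esub> f = \<zero>\<^bsub>?R\<^esub>"
        by (rule bexI[rotated]) (auto simp: ops restrict_def)
      show "\<zero>\<^bsub>?R\<^esub> \<oplus>\<^bsub>?R\<^esub> f = f"
        using ext[OF f] by (simp add: ops cong: restrict_cong)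
    qed (assumption | rule closed const_closed | simp add: ops fun_eq_iff algebra_simps)+
    show "Group.monoid ?R"
    proof (rule monoidI)
      fix f assume f: "f \<in> carrier ?R"
      show "\<one>\<^bsub>?R\<^esub> \<otimes>\<^bsub>?R\<^esub> f = f" "f \<otimes>\<^bsub>?R\<^esub> \<one>\<^bsub>?R\<^esub> = f"
        using ext[OF f] by (simp_all add: ops cong: restrict_cong)
    qed (assumption | rule closed const_closed | simp add: ops fun_eq_iff algebra_simps)+
  qed (auto simp: ops restrict_def algebra_simps)
qed

lemma T_in_entry_polys:
  assumes "set w \<subseteq> {1..k}"
  shows "T w \<in> (entry_polys k :: ((nat \<Rightarrow> 'a::field^2^2) \<Rightarrow> 'a) set)"
proof -
  let ?E = "entry_polys k :: ((nat \<Rightarrow> 'a^2^2) \<Rightarrow> 'a) set"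
  \<comment> \<open>The induction needs all entries of the product, not only the trace.\<close>
  have "(\<lambda>A. word_prod A w $ r $ c) \<in> ?E" for r c
    using assms
  proof (induction w arbitrary: r c)
    case Nil
    show ?case by (simp add: mat_def poly_funs_const)
  next
    case (Cons i w)
    have "(\<lambda>A. A i $ r $ c) \<in> ?E" for r c
      using poly_funs_coord[of "(i, r, c)" "{1..k} \<times> UNIV \<times> UNIV" "\<lambda>A (i, r, c). A i $ r $ c"]
        Cons.prems by simp
    moreover have "(\<lambda>A. word_prod A w $ r $ c) \<in> ?E" for r c
      using Cons by simp
    ultimately show ?case
      unfolding word_prod_simps matrix_mult_2 by (intro poly_funs_add poly_funs_mult)
  qed
  then show ?thesis
    unfolding T_eq[abs_def] trace_2 by (intro poly_funs_add)
qed

section \<open>Evaluation at the traces and its image\<close>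

lemma mpoly_eval_closed:
  fixes p :: "('v, 'a::comm_ring_1) mpoly" and y :: "'b \<Rightarrow> 'v \<Rightarrow> 'a"
  assumes "p \<in> carrier (mpoly_ring W)"
    and const: "\<And>c. Q (\<lambda>A. c)"
    and add: "\<And>f g. Q f \<Longrightarrow> Q g \<Longrightarrow> Q (\<lambda>A. f A + g A)"
    and mult: "\<And>f g. Q f \<Longrightarrow> Q g \<Longrightarrow> Q (\<lambda>A. f A * g A)"
    and coord: "\<And>w. w \<in> W \<Longrightarrow> Q (\<lambda>A. y A w)"
  shows "Q (\<lambda>A. mpoly_eval (y A) p)"
proof -
  \<comment> \<open>Closure passes to powers, finite products and finite sums, hence to evaluations.
    \<open>Q\<close> will be membership in the regular functions, then in the generated
    subring.\<close>
  have pow: "Q (\<lambda>A. y A w ^ n)" if "w \<in> W" for w n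
    by (induction n) (auto intro!: const mult coord that)
  have prod: "Q (\<lambda>A. \<Prod>w\<in>M. y A w ^ n w)" if "M \<subseteq> W" for M n
    using that by (induction M rule: infinite_finite_induct) (auto intro!: const mult pow)
  have sum: "Q (\<lambda>A. \<Sum>m\<in>M. f m A)" if "\<And>m. m \<in> M \<Longrightarrow> Q (f m)" for M and f :: "('v \<Rightarrow>\<^sub>0 nat) \<Rightarrow> 'b \<Rightarrow> 'a"
    using that by (induction M rule: infinite_finite_induct) (auto intro!: const add)
  show ?thesis
    unfolding mpoly_eval_def
    using assms(1) by (intro sum mult const prod) (auto simp: mpoly_ring_def)
qed

text \<open>The restriction makes the values extensional, as in \<open>regular_ring\<close>. The
  kernel will be the ideal of relations, the image the coordinate ring.\<close>

definition T_eval :: "nat \<Rightarrow> (nat list, 'a::field) mpoly \<Rightarrow> (nat \<Rightarrow> 'a^2^2) \<Rightarrow> 'a" where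
  "T_eval k p = (\<lambda>A\<in>SL2_tuples k. mpoly_eval (\<lambda>I. T I A) p)"

lemma T_eval_ring_hom:
  "ring_hom_ring (mpoly_ring (T_indices k)) (regular_ring k) (T_eval k :: (nat list, 'a::field) mpoly \<Rightarrow> _)"
proof (rule ring_hom_ringI[OF ring_mpoly_ring ring_regular_ring])
  fix p :: "(nat list, 'a) mpoly" assume "p \<in> carrier (mpoly_ring (T_indices k))"
  then have "(\<lambda>A. mpoly_eval (\<lambda>I. T I A) p) \<in> entry_polys k"
  proof (rule mpoly_eval_closed[where Q = "\<lambda>f. f \<in> entry_polys k"])
    fix I assume "I \<in> T_indices k"
    then show "(\<lambda>A. T I A) \<in> entry_polys k"
      by (intro T_in_entry_polys) (simp add: T_indices_def)
  qed (rule poly_funs_intros; assumption?)+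
  then show "T_eval k p \<in> carrier (regular_ring k)"
    unfolding T_eval_def by (rule restrict_in_regular_ring)
qed (simp_all add: T_eval_def mpoly_ring_def regular_ring_def fun_eq_iff)

lemma T_eval_image:
  "T_eval k ` carrier (mpoly_ring (T_indices k)) = {f \<in> extensional (SL2_tuples k). f \<in> T_polys k}"
proof (intro equalityI subsetI)
  fix f assume f: "f \<in> {f \<in> extensional (SL2_tuples k). f \<in> T_polys k}"
  then obtain p where p: "p \<in> carrier (mpoly_ring (T_indices k))"
    "\<And>A. A \<in> SL2_tuples k \<Longrightarrow> f A = mpoly_eval (\<lambda>I. T I A) p"
    by (auto simp: poly_funs_def)
  then have "f = T_eval k p"
    using f by (intro extensionalityI[of f "SL2_tuples k"]) (auto simp: T_eval_def)
  with p show "f \<in> T_eval k ` carrier (mpoly_ring (T_indices k))" by blast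
qed (auto simp: T_eval_def poly_funs_def)

text \<open>The image of \<open>T_eval\<close> is a subring containing all generators, by
  \<open>trace_rep_of_tuple\<close>. Conversely each \<open>T I\<close> is the trace function of a
  positive word, so polynomials in the \<open>T I\<close> lie in the generated subring.\<close>

lemma coordinate_ring_carrier:
  assumes char: "CHAR('a::field) \<noteq> 2 \<or> k \<le> 3"
  shows "carrier (coordinate_ring k :: ((nat \<Rightarrow> 'a^2^2) \<Rightarrow> 'a) ring)
    = T_eval k ` carrier (mpoly_ring (T_indices k))"
proof -
  let ?R = "regular_ring k :: ((nat \<Rightarrow> 'a^2^2) \<Rightarrow> 'a) ring"
  let ?P = "mpoly_ring (T_indices k) :: (nat list, 'a) mpoly ring"
  let ?H = "constant_functions k \<union> trace_functions k :: ((nat \<Rightarrow> 'a^2^2) \<Rightarrow> 'a) set"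
  interpret h: ring_hom_ring ?P ?R "T_eval k" by (rule T_eval_ring_hom)
  have img: "subring (T_eval k ` carrier ?P) ?R"
    by (rule h.img_is_subring[OF h.R.carrier_is_subring])
  have H: "?H \<subseteq> T_eval k ` carrier ?P"
  proof -
    have "restrict f (SL2_tuples k) \<in> T_eval k ` carrier ?P" if "f \<in> T_polys k" for f
      using that unfolding T_eval_image by (simp add: poly_funs_restrict)
    then show ?thesis
      using trace_rep_of_tuple[OF char]
      by (auto simp: constant_functions_def trace_functions_def free_group_def intro: poly_funs_const)
  qed
  then have H_carrier: "?H \<subseteq> carrier ?R" using subringE(1)[OF img] by blast
  have sub: "subring (generate_ring ?R ?H) ?R"
    by (rule h.S.generate_ring_is_subring[OF H_carrier])
  have "T_eval k p \<in> generate_ring ?R ?H" if "p \<in> carrier ?P" for p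
    unfolding T_eval_def
  proof (rule mpoly_eval_closed[where Q = "\<lambda>f. restrict f (SL2_tuples k) \<in> generate_ring ?R ?H", OF that])
    fix c :: 'a
    show "(\<lambda>A\<in>SL2_tuples k. c) \<in> generate_ring ?R ?H"
      by (rule generate_ring.incl) (auto simp: constant_functions_def)
  next
    fix f g :: "(nat \<Rightarrow> 'a^2^2) \<Rightarrow> 'a"
    assume "restrict f (SL2_tuples k) \<in> generate_ring ?R ?H" "restrict g (SL2_tuples k) \<in> generate_ring ?R ?H"
    from subringE(6,7)[OF sub this]
    show "(\<lambda>A\<in>SL2_tuples k. f A + g A) \<in> generate_ring ?R ?H"
      "(\<lambda>A\<in>SL2_tuples k. f A * g A) \<in> generate_ring ?R ?H"
      by (simp_all add: regular_ring_def cong: restrict_cong)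
  next
    fix I assume I: "I \<in> T_indices k"
    let ?g = "map (\<lambda>i. (i, True)) I"
    have "?g \<in> carrier (free_group k)"
      using I by (intro positive_word_in_free_group) (simp add: T_indices_def)
    moreover have "restrict (T I) (SL2_tuples k) = (\<lambda>A\<in>SL2_tuples k. trace (rep_of_tuple A ?g) :: 'a)"
      by (simp add: T_eq[abs_def] rep_of_tuple_positive)
    ultimately show "restrict (T I) (SL2_tuples k) \<in> generate_ring ?R ?H"
      unfolding trace_functions_def by (intro generate_ring.incl UnI2) blast
  qed
  moreover have "generate_ring ?R ?H \<subseteq> T_eval k ` carrier ?P"
    by (rule h.S.generate_ring_min_subring1[OF H_carrier img H])
  ultimately show ?thesis by (auto simp: coordinate_ring_def)
qed

theorem theorem1p1:
  fixes k :: nat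
  assumes "1 \<le> k"
    and "CHAR('a::alg_closed_field) \<noteq> 2 \<or> k \<le> 3"
  shows "inj_on (T_coordinates k) (character_variety k :: (letter list \<Rightarrow> 'a) set) \<and>
    (\<forall>x :: (nat \<times> int) list. fst ` set x \<subseteq> {1..k} \<longrightarrow>
      (\<exists>p \<in> carrier (mpoly_ring (T_indices k) :: (nat list, 'a) mpoly ring).
        \<forall>A \<in> SL2_tuples k. trace (monomial_value A x) = mpoly_eval (\<lambda>I. T I A) p)) \<and>
    (\<exists>\<I> \<phi>. ideal \<I> (mpoly_ring (T_indices k) :: (nat list, 'a) mpoly ring) \<and>
      \<phi> \<in> ring_iso (mpoly_ring (T_indices k) Quot \<I>) (coordinate_ring k) \<and>
      (\<forall>p \<in> carrier (mpoly_ring (T_indices k)).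
        \<phi> (\<I> +>\<^bsub>mpoly_ring (T_indices k)\<^esub> p) =
          (\<lambda>A \<in> SL2_tuples k. mpoly_eval (\<lambda>I. T I A) p)))"
proof (intro conjI allI impI)
  show "inj_on (T_coordinates k) (character_variety k :: (letter list \<Rightarrow> 'a) set)"
    by (rule inj_on_T_coordinates[OF assms(2)])
next
  fix x :: "(nat \<times> int) list" assume "fst ` set x \<subseteq> {1..k}"
  from trace_monomial_value[OF assms(2) this]
  show "\<exists>p \<in> carrier (mpoly_ring (T_indices k) :: (nat list, 'a) mpoly ring).
      \<forall>A \<in> SL2_tuples k. trace (monomial_value A x) = mpoly_eval (\<lambda>I. T I A) p"
    by (simp add: poly_funs_def)
next
  let ?R = "regular_ring k :: ((nat \<Rightarrow> 'a^2^2) \<Rightarrow> 'a) ring"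
  let ?P = "mpoly_ring (T_indices k) :: (nat list, 'a) mpoly ring"
  let ?h = "T_eval k :: (nat list, 'a) mpoly \<Rightarrow> (nat \<Rightarrow> 'a^2^2) \<Rightarrow> 'a"
  interpret h: ring_hom_ring ?P ?R ?h by (rule T_eval_ring_hom)
  \<comment> \<open>Written as the image ring of \<open>?h\<close>, the coordinate ring is
    accessible to the first isomorphism theorem.\<close>
  have "coordinate_ring k = ?R\<lparr>carrier := ?h ` carrier ?P\<rparr>"
    using coordinate_ring_carrier[OF assms(2)] by (simp add: coordinate_ring_def)
  then have "(\<lambda>X. the_elem (?h ` X)) \<in> ring_iso (?P Quot a_kernel ?P ?R ?h) (coordinate_ring k)"
    using h.FactRing_iso_set_aux by simp
  then show "\<exists>\<I> \<phi>. ideal \<I> ?P \<and> \<phi> \<in> ring_iso (?P Quot \<I>) (coordinate_ring k) \<and>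
      (\<forall>p \<in> carrier ?P. \<phi> (\<I> +>\<^bsub>?P\<^esub> p) = (\<lambda>A \<in> SL2_tuples k. mpoly_eval (\<lambda>I. T I A) p))"
    \<comment> \<open>The ideal is the kernel, that is, all polynomial relations among the traces;
      the isomorphism sends a coset to the single value that \<open>?h\<close> takes on it.\<close>
    using h.kernel_is_ideal
    by (intro exI[of _ "a_kernel ?P ?R ?h"] exI[of _ "\<lambda>X. the_elem (?h ` X)"])
      (simp add: h.the_elem_simp T_eval_def[symmetric])
qed

end
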